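(* Let $A$ be an associative algebra. (i) If $Ann_A^l(A)=0$, and in particular if $A$ has a right-regular element, then $HU_t(A)=HU_n(A)=Z(A)$. (ii) If $Ann_A^r(A)=0$, and in particular if $A$ has a left-regular element, then $HU_t(A)=HU_n(A)=Z(A)$.
   Context: $A$ is an associative algebra over a field $\mathbb{F}$, not necessarily commutative or unital. $Ann_A^l(A)=\{a\in A\mid a\cdot x=0\ \forall x\in A\}$ and $Ann_A^r(A)=\{a\in A\mid x\cdot a=0\ \forall x\in A\}$. An element $a$ is left-regular if $a\cdot x\neq 0$ for all $x\in A\setminus\{0\}$, and right-regular if $x\cdot a\neq 0$ for all $x\in A\setminus\{0\}$. $Z(A)=\{a\mid a\cdot x=x\cdot a\ \forall x\in A\}$. With $L_a\colon x\mapsto a\cdot x$, $R_a\colon x\mapsto x\cdot a$, and $(A,\alpha)$ hom-associative meaning $\alpha(x)\cdot(y\cdot z)=(x\cdot y)\cdot\alpha(z)$ for all $x,y,z$: $HU_t^l(A)=\{a\in A\mid (A,L_a)\text{ is hom-associative}\}=\{a\mid (a\cdot x\cdot y-x\cdot y\cdot a)\cdot z=0\ \forall x,y,z\in A\}$; $HU_t^r(A)=\{a\in A\mid (A,R_a)\text{ is hom-associative}\}=\{a\mid x\cdot(a\cdot y\cdot z-y\cdot z\cdot a)=0\ \forall x,y,z\in A\}$; $HU_t(A)=HU_t^l(A)\cap HU_t^r(A)$. In general $HU_n(A)=Z(A)\cap N(A)\cap Ann_A^l([A,A,A]_{\mathrm{as}})$, where $N(A)$ is the nucleus (elements associating with all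 elements in all positions), $[A,A,A]_{\mathrm{as}}$ is the set of associators $(x\cdot y)\cdot z-x\cdot(y\cdot z)$, and $Ann_A^l(S)=\{a\mid a\cdot s=0\ \forall s\in S\}$. *)

theory Defs
  imports Complex_Main
begin

locale nonassoc_algebra = vector_space scale
  for scale :: "'f::field \<Rightarrow> 'a::ab_group_add \<Rightarrow> 'a" +
  fixes mult :: "'a \<Rightarrow> 'a \<Rightarrow> 'a"
  assumes linear_mult_left: "Vector_Spaces.linear scale scale (\<lambda>x. mult a x)"
    and linear_mult_right: "Vector_Spaces.linear scale scale (\<lambda>x. mult x a)"

locale assoc_algebra = nonassoc_algebra +
  assumes mult_assoc: "mult (mult x y) z = mult x (mult y z)"

definition associator :: "('a::ab_group_add \<Rightarrow> 'a \<Rightarrow> 'a) \<Rightarrow> 'a \<Rightarrow> 'a \<Rightarrow> 'a \<Rightarrow> 'a" where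
  "associator mult x y z = mult (mult x y) z - mult x (mult y z)"

definition left_annihilator :: "('a::ab_group_add \<Rightarrow> 'a \<Rightarrow> 'a) \<Rightarrow> 'a set \<Rightarrow> 'a set" where
  "left_annihilator mult S = {a. \<forall>s\<in>S. mult a s = 0}"

definition right_annihilator :: "('a::ab_group_add \<Rightarrow> 'a \<Rightarrow> 'a) \<Rightarrow> 'a set \<Rightarrow> 'a set" where
  "right_annihilator mult S = {a. \<forall>s\<in>S. mult s a = 0}"

definition left_regular :: "('a::ab_group_add \<Rightarrow> 'a \<Rightarrow> 'a) \<Rightarrow> 'a \<Rightarrow> bool" where
  "left_regular mult a \<longleftrightarrow> (\<forall>x. x \<noteq> 0 \<longrightarrow> mult a x \<noteq> 0)"

definition right_regular :: "('a::ab_group_add \<Rightarrow> 'a \<Rightarrow> 'a) \<Rightarrow> 'a \<Rightarrow> bool" where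
  "right_regular mult a \<longleftrightarrow> (\<forall>x. x \<noteq> 0 \<longrightarrow> mult x a \<noteq> 0)"

text \<open>The center used here consists of the elements commuting with everything; for a
  non-associative multiplication it is not required to lie in the nucleus.\<close>

definition center :: "('a \<Rightarrow> 'a \<Rightarrow> 'a) \<Rightarrow> 'a set" where
  "center mult = {a. \<forall>x. mult a x = mult x a}"

definition nucleus :: "('a::ab_group_add \<Rightarrow> 'a \<Rightarrow> 'a) \<Rightarrow> 'a set" where
  "nucleus mult = {a. \<forall>x y. associator mult a x y = 0 \<and> associator mult x a y = 0
                          \<and> associator mult x y a = 0}"

definition hom_associative :: "('a \<Rightarrow> 'a \<Rightarrow> 'a) \<Rightarrow> ('a \<Rightarrow> 'a) \<Rightarrow> bool" where
  "hom_associative mult \<alpha> \<longleftrightarrow>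
     (\<forall>x y z. mult (\<alpha> x) (mult y z) = mult (mult x y) (\<alpha> z))"

definition HU_t_left :: "('a \<Rightarrow> 'a \<Rightarrow> 'a) \<Rightarrow> 'a set" where
  "HU_t_left mult = {a. hom_associative mult (\<lambda>x. mult a x)}"

definition HU_t_right :: "('a \<Rightarrow> 'a \<Rightarrow> 'a) \<Rightarrow> 'a set" where
  "HU_t_right mult = {a. hom_associative mult (\<lambda>x. mult x a)}"

definition HU_t :: "('a \<Rightarrow> 'a \<Rightarrow> 'a) \<Rightarrow> 'a set" where
  "HU_t mult = HU_t_left mult \<inter> HU_t_right mult"

text \<open>This set is given for an arbitrary, possibly non-associative, algebra; when the
  multiplication is associative, the last two of the three sets are everything.\<close>

definition HU_n :: "('a::ab_group_add \<Rightarrow> 'a \<Rightarrow> 'a) \<Rightarrow> 'a set" where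
  "HU_n mult = center mult \<inter> nucleus mult
     \<inter> left_annihilator mult {associator mult x y z | x y z. True}"

end

theory Submission
  imports Defs
begin

text \<open>
  Every associator vanishes, so \<open>HU_n\<close> is the center, and the center always lies in \<open>HU_t\<close>;
  only the inclusion of \<open>HU_t\<close> in the center needs an argument.  If \<open>a \<in> HU_t\<close> and one of the
  two annihilators of the algebra is zero, then a factor can be cancelled from the corresponding
  half of the hom-associativity conditions, which leaves \<open>a (x y) = (x y) a\<close>: the element \<open>a\<close>
  commutes with every product.  Such an element can be moved across products to see that every
  commutator \<open>a x - x a\<close> kills all products of two elements, from either side.  Cancelling
  two more factors, the commutator is zero, and \<open>a\<close> is central.

  A right-regular element \<open>b\<close> makes the left annihilator trivial because \<open>a b = 0\<close>
  already forces \<open>a = 0\<close>; the left-regular case is its mirror image.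
\<close>

context nonassoc_algebra
begin

lemma mult_zero_right: "mult x 0 = 0"
  using linear_mult_left[of x] by (simp add: linear_iff_module_hom module_hom.zero)

lemma mult_zero_left: "mult 0 x = 0"
  using linear_mult_right[of x]
  by (simp add: linear_iff_module_hom module_hom.zero[where f = "\<lambda>u. mult u x"])

lemma mult_diff_right: "mult x (y - z) = mult x y - mult x z"
  using linear_mult_left[of x] by (simp add: linear_iff_module_hom module_hom.diff)

lemma mult_diff_left: "mult (y - z) x = mult y x - mult z x"
  using linear_mult_right[of x]
  by (simp add: linear_iff_module_hom module_hom.diff[where f = "\<lambda>u. mult u x"])

lemma left_annihilator_trivial_if_right_regular:
  assumes "right_regular mult b"
  shows "left_annihilator mult UNIV = {0}"
  using assms mult_zero_left by (auto simp: left_annihilator_def right_regular_def)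

lemma right_annihilator_trivial_if_left_regular:
  assumes "left_regular mult b"
  shows "right_annihilator mult UNIV = {0}"
  using assms mult_zero_right by (auto simp: right_annihilator_def left_regular_def)

lemma eq_if_left_annihilator_trivial:
  assumes "left_annihilator mult UNIV = {0}" and "\<And>z. mult u z = mult v z"
  shows "u = v"
proof -
  have "u - v \<in> left_annihilator mult UNIV"
    using assms(2) by (simp add: left_annihilator_def mult_diff_left)
  then show ?thesis using assms(1) by simp
qed

lemma eq_if_right_annihilator_trivial:
  assumes "right_annihilator mult UNIV = {0}" and "\<And>z. mult z u = mult z v"
  shows "u = v"
proof -
  have "u - v \<in> right_annihilator mult UNIV"
    using assms(2) by (simp add: right_annihilator_def mult_diff_right)
  then show ?thesis using assms(1) by simp
qed

end

context assoc_algebra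
begin

lemma HU_n_eq_center: "HU_n mult = center mult"
  by (auto simp: HU_n_def nucleus_def left_annihilator_def associator_def mult_assoc
      mult_zero_right)

lemma center_subset_HU_t: "center mult \<subseteq> HU_t mult"
proof
  fix a
  assume "a \<in> center mult"
  then have comm: "mult a x = mult x a" for x
    by (simp add: center_def)
  have "mult (mult a x) (mult y z) = mult (mult x y) (mult a z)" for x y z
    using comm[of "mult x y"] by (metis mult_assoc)
  moreover have "mult (mult x a) (mult y z) = mult (mult x y) (mult z a)" for x y z
    using comm[of "mult y z"] by (metis mult_assoc)
  ultimately show "a \<in> HU_t mult"
    by (simp add: HU_t_def HU_t_left_def HU_t_right_def hom_associative_def)
qed

text \<open>
  Moving \<open>a\<close> across the product \<open>y z\<close> turns \<open>x a y z\<close> into \<open>x y z a\<close>, and moving it across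
  \<open>x (y z)\<close> gives \<open>a x y z\<close>.  Hence \<open>a x\<close> and \<open>x a\<close> act in the same way on products, although
  \<open>a\<close> is not assumed to commute with \<open>x\<close>.
\<close>
lemma commutator_mult_product:
  assumes comm: "\<And>x y. mult a (mult x y) = mult (mult x y) a"
  shows "mult (mult a x) (mult y z) = mult (mult x a) (mult y z)"
proof -
  have "mult (mult x a) (mult y z) = mult x (mult (mult y z) a)"
    by (simp only: mult_assoc[of x a] comm)
  also have "\<dots> = mult a (mult x (mult y z))"
    by (simp only: comm mult_assoc)
  finally show ?thesis by (simp only: mult_assoc)
qed

text \<open>The same computation with the product on the left.\<close>
lemma product_mult_commutator:
  assumes comm: "\<And>x y. mult a (mult x y) = mult (mult x y) a"
  shows "mult (mult z y) (mult a x) = mult (mult z y) (mult x a)"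
proof -
  have "mult (mult z y) (mult a x) = mult (mult a (mult z y)) x"
    by (simp only: comm mult_assoc)
  also have "\<dots> = mult (mult (mult z y) x) a"
    by (metis comm mult_assoc)
  finally show ?thesis by (simp only: mult_assoc)
qed

lemma HU_t_left_subset_center:
  assumes ann: "left_annihilator mult UNIV = {0}"
  shows "HU_t_left mult \<subseteq> center mult"
proof
  fix a
  assume "a \<in> HU_t_left mult"
  then have hom: "mult (mult a x) (mult y z) = mult (mult x y) (mult a z)" for x y z
    by (simp add: HU_t_left_def hom_associative_def)
  have comm: "mult a (mult x y) = mult (mult x y) a" for x y
    by (rule eq_if_left_annihilator_trivial[OF ann]) (use hom in \<open>simp add: mult_assoc\<close>)
  have "mult (mult a x) y = mult (mult x a) y" for x y
    by (rule eq_if_left_annihilator_trivial[OF ann])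
      (simp only: mult_assoc[of _ y] commutator_mult_product[OF comm])
  then have "mult a x = mult x a" for x
    by (rule eq_if_left_annihilator_trivial[OF ann])
  then show "a \<in> center mult" by (simp add: center_def)
qed

lemma HU_t_right_subset_center:
  assumes ann: "right_annihilator mult UNIV = {0}"
  shows "HU_t_right mult \<subseteq> center mult"
proof
  fix a
  assume "a \<in> HU_t_right mult"
  then have hom: "mult (mult x a) (mult y z) = mult (mult x y) (mult z a)" for x y z
    by (simp add: HU_t_right_def hom_associative_def)
  have comm: "mult a (mult x y) = mult (mult x y) a" for x y
    by (rule eq_if_right_annihilator_trivial[OF ann]) (use hom in \<open>simp add: mult_assoc\<close>)
  have "mult y (mult a x) = mult y (mult x a)" for x y
    by (rule eq_if_right_annihilator_trivial[OF ann])
      (simp only: mult_assoc[of _ y, symmetric] product_mult_commutator[OF comm])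
  then have "mult a x = mult x a" for x
    by (rule eq_if_right_annihilator_trivial[OF ann])
  then show "a \<in> center mult" by (simp add: center_def)
qed

lemma HU_t_eq_center:
  assumes "left_annihilator mult UNIV = {0} \<or> right_annihilator mult UNIV = {0}"
  shows "HU_t mult = center mult"
  using assms center_subset_HU_t HU_t_left_subset_center HU_t_right_subset_center
  by (auto simp: HU_t_def)

end

theorem proposition63:
  fixes scale :: "'f::field \<Rightarrow> 'a::ab_group_add \<Rightarrow> 'a"
    and mult :: "'a \<Rightarrow> 'a \<Rightarrow> 'a"
  assumes "assoc_algebra scale mult"
  shows "(left_annihilator mult UNIV = {0} \<longrightarrow>
            HU_t mult = HU_n mult \<and> HU_n mult = center mult) \<and>
         ((\<exists>a. right_regular mult a) \<longrightarrow>
            left_annihilator mult UNIV = {0} \<and>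
            HU_t mult = HU_n mult \<and> HU_n mult = center mult) \<and>
         (right_annihilator mult UNIV = {0} \<longrightarrow>
            HU_t mult = HU_n mult \<and> HU_n mult = center mult) \<and>
         ((\<exists>a. left_regular mult a) \<longrightarrow>
            right_annihilator mult UNIV = {0} \<and>
            HU_t mult = HU_n mult \<and> HU_n mult = center mult)"
proof -
  interpret assoc_algebra scale mult by (rule assms)
  show ?thesis
    using HU_n_eq_center HU_t_eq_center left_annihilator_trivial_if_right_regular
      right_annihilator_trivial_if_left_regular
    by metis
qed

end
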